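(* For integers $j\ge1$ define functions on $x>-1$ by $f_{0,j}(x)=\ln^j(1+x)$ and $f_{n,j}(x)=\int_0^x f_{n-1,j}(t)\,dt$ for $n\ge1$. Then for all $n\ge0$ and $j\ge1$ there are polynomials $A_{n,j}(x)$ and $B_{n,k,j}(x)$ ($1\le k\le j$) such that $$f_{n,j}(x)=A_{n,j}(x)+\sum_{k=1}^{j}B_{n,k,j}(x)\ln^k(1+x),$$ and moreover $B_{n,k,j}(x)=b_{n,k,j}(1+x)^n$ for some $b_{n,k,j}\in\mathbb{Q}$. *)

theory Defs
  imports "HOL-Analysis.Analysis" "HOL-Computational_Algebra.Polynomial"
begin

(* Only the values at x > -1 are meaningful. The interval Lebesgue integral is oriented,
   so for -1 < x < 0 the integral from 0 to x is minus the integral over (x, 0). *)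
primrec iter_log :: "nat \<Rightarrow> nat \<Rightarrow> real \<Rightarrow> real" where
  "iter_log 0 j = (\<lambda>x. ln (1 + x) ^ j)"
| "iter_log (Suc n) j = (\<lambda>x. LBINT t=ereal 0..ereal x. iter_log n j t)"

end

theory Submission
  imports Defs
begin

text \<open>With \<open>L = ln (1 + x)\<close>, the derivative of \<open>(1 + x) ^ Suc n * Q(L)\<close> is
  \<open>(1 + x) ^ n * ((n + 1) * Q + Q')(L)\<close>. Since \<open>Q \<mapsto> (n + 1) * Q + Q'\<close> is invertible on rational
  polynomials of bounded degree, each integration preserves the form
  \<open>A(x) + (1 + x) ^ n * P(L)\<close> with \<open>P\<close> rational of degree at most \<open>j\<close>; the
  constant term of \<open>P\<close> is finally moved into \<open>A\<close>.\<close>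

lemma exists_antiderivative_poly:
  fixes p :: "'a :: field_char_0 poly"
  shows "\<exists>q. pderiv q = p"
proof
  have "pderiv (\<Sum>i\<le>degree p. monom (coeff p i / of_nat (Suc i)) (Suc i))
      = (\<Sum>i\<le>degree p. monom (coeff p i) i)"
    \<comment> \<open>At order 1 the rule differentiates the sum term by term; keeping
      \<open>of_nat (Suc i)\<close> folded lets it cancel against the denominator.\<close>
    unfolding higher_pderiv_sum[of 1, simplified] pderiv_monom by (intro sum.cong refl) (simp del: of_nat_Suc)
  then show "pderiv (\<Sum>i\<le>degree p. monom (coeff p i / of_nat (Suc i)) (Suc i)) = p"
    by (simp only: poly_as_sum_of_monoms)
qed

text \<open>Since \<open>pderiv\<close> lowers the degree, \<open>smult (1 / m) p\<close> solves the
  equation up to an error of smaller degree, and induction on the degree bound removes that error.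
  Only division by the rational \<open>m\<close> occurs, so coefficients stay rational.\<close>

lemma exists_poly_smult_add_pderiv:
  fixes p :: "real poly"
  assumes "m \<in> \<rat>" "m \<noteq> 0" "\<And>i. coeff p i \<in> \<rat>" "degree p \<le> d"
  shows "\<exists>q. smult m q + pderiv q = p \<and> (\<forall>i. coeff q i \<in> \<rat>) \<and> degree q \<le> d"
  using assms(3,4)
proof (induction d arbitrary: p)
  case 0
  then have "pderiv p = 0"
    by (simp add: pderiv_eq_0_iff)
  with 0 assms(1,2) show ?case
    by (intro exI[of _ "smult (1 / m) p"]) (simp add: pderiv_smult)
next
  case (Suc d)
  \<comment> \<open>The trial solution \<open>smult (1 / m) p\<close> yields \<open>p - ?r\<close>,
    so the correction \<open>q\<close> has to produce \<open>?r\<close>.\<close>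
  let ?r = "- smult (1 / m) (pderiv p)"
  have "coeff ?r i \<in> \<rat>" for i
    using Suc.prems(1) assms(1) by (simp add: coeff_pderiv Rats_mult Rats_add)
  moreover have "degree ?r \<le> d"
    using Suc.prems(2) by (auto simp: degree_pderiv)
  ultimately obtain q where q: "smult m q + pderiv q = ?r" "\<And>i. coeff q i \<in> \<rat>" "degree q \<le> d"
    using Suc.IH by blast
  have "smult m (smult (1 / m) p + q) + pderiv (smult (1 / m) p + q)
      = p + (smult (1 / m) (pderiv p) + (smult m q + pderiv q))"
    using assms(2) by (simp add: pderiv_add pderiv_smult smult_add_right)
  then have "smult m (smult (1 / m) p + q) + pderiv (smult (1 / m) p + q) = p"
    unfolding q(1) by simp
  moreover have "coeff (smult (1 / m) p + q) i \<in> \<rat>" for i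
    using Suc.prems(1) q(2) assms(1) by simp
  moreover have "degree (smult (1 / m) p + q) \<le> Suc d"
    using Suc.prems(2) q(3) by (intro degree_add_le) auto
  ultimately show ?case
    by blast
qed

lemma has_real_derivative_power_mult_poly_ln:
  assumes "x > -1"
  shows "((\<lambda>x. (1 + x) ^ Suc n * poly q (ln (1 + x))) has_real_derivative
      (1 + x) ^ n * poly (smult (real (Suc n)) q + pderiv q) (ln (1 + x))) (at x)"
proof -
  have "((\<lambda>x. (1 + x) ^ Suc n) has_real_derivative real (Suc n) * (1 + x) ^ n) (at x)"
    by (rule derivative_eq_intros refl | simp)+
  moreover have "((\<lambda>x. poly q (ln (1 + x))) has_real_derivative
      poly (pderiv q) (ln (1 + x)) * (1 / (1 + x))) (at x)"
    using assms by (intro DERIV_chain2[OF poly_DERIV]) (auto intro!: derivative_eq_intros)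
  ultimately have "((\<lambda>x. (1 + x) ^ Suc n * poly q (ln (1 + x))) has_real_derivative
      real (Suc n) * (1 + x) ^ n * poly q (ln (1 + x)) +
      poly (pderiv q) (ln (1 + x)) * (1 / (1 + x)) * (1 + x) ^ Suc n) (at x)"
    by (rule DERIV_mult)
  then show ?thesis
    by (rule DERIV_cong) (use assms in \<open>simp add: field_simps\<close>)
qed

text \<open>\<open>P\<close> may have a constant term because solving for the next \<open>P\<close>
  creates one even from \<open>monom 1 j\<close>. Rationality is tracked for \<open>P\<close> only,
  so \<open>A\<close> can absorb constants of integration.\<close>

lemma iter_log_eq:
  "\<exists>A P. (\<forall>x>-1. iter_log n j x = poly A x + (1 + x) ^ n * poly P (ln (1 + x))) \<and>
    (\<forall>i. coeff P i \<in> \<rat>) \<and> degree P \<le> j"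
proof (induction n)
  case 0
  show ?case
    by (intro exI[of _ 0] exI[of _ "monom 1 j"]) (simp add: poly_monom degree_monom_eq)
next
  case (Suc n)
  then obtain A P where
    f: "\<And>x. x > -1 \<Longrightarrow> iter_log n j x = poly A x + (1 + x) ^ n * poly P (ln (1 + x))"
    and P: "\<And>i. coeff P i \<in> \<rat>" "degree P \<le> j"
    by blast
  obtain C where C: "pderiv C = A"
    using exists_antiderivative_poly by blast
  obtain Q where Q: "smult (real (Suc n)) Q + pderiv Q = P" "\<forall>i. coeff Q i \<in> \<rat>" "degree Q \<le> j"
    using exists_poly_smult_add_pderiv[of "real (Suc n)" P j] P by auto
  \<comment> \<open>An explicit antiderivative of \<open>iter_log n j\<close> on x > -1:
    \<open>C\<close> accounts for \<open>A\<close>, and \<open>Q\<close> for the logarithmic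
    part.\<close>
  define F where "F x = poly C x + (1 + x) ^ Suc n * poly Q (ln (1 + x))" for x
  have F: "(F has_real_derivative iter_log n j x) (at x)" if "x > -1" for x
    unfolding F_def f[OF that] Q(1)[symmetric] C[symmetric]
    by (intro DERIV_add poly_DERIV has_real_derivative_power_mult_poly_ln that)
  have cont: "continuous_on {-1<..} (iter_log n j)"
  proof -
    have "continuous_on {-1<..} (\<lambda>x. poly A x + (1 + x) ^ n * poly P (ln (1 + x)))"
      by (auto intro!: continuous_intros)
    then show ?thesis
      by (rule continuous_on_eq) (simp add: f)
  qed
  have "iter_log (Suc n) j x = F x - F 0" if "x > -1" for x
  proof -
    \<comment> \<open>The min/max form covers both orientations of the integral, x < 0
      included.\<close>
    have sub: "{min 0 x..max 0 x} \<subseteq> {-1<..}"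
      using that by auto
    have "(LBINT t=ereal 0..ereal x. iter_log n j t) = F x - F 0"
    proof (rule interval_integral_FTC_finite)
      show "continuous_on {min 0 x..max 0 x} (iter_log n j)"
        using cont sub by (rule continuous_on_subset)
      show "(F has_vector_derivative iter_log n j t) (at t within {min 0 x..max 0 x})"
        if "min 0 x \<le> t" "t \<le> max 0 x" for t
      proof -
        have "t > -1"
          using sub that by auto
        from has_field_derivative_at_within[OF F[OF this]] show ?thesis
          by (simp add: has_real_derivative_iff_has_vector_derivative)
      qed
    qed
    then show ?thesis
      by simp
  qed
  \<comment> \<open>The constant \<open>F 0\<close> goes into the polynomial part, leaving
    \<open>Q\<close> untouched.\<close>
  then have "\<forall>x>-1. iter_log (Suc n) j x
      = poly (C - [:F 0:]) x + (1 + x) ^ Suc n * poly Q (ln (1 + x))"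
    unfolding F_def by simp
  with Q show ?case
    by blast
qed

theorem theorem5p1:
  fixes n j :: nat
  assumes "j \<ge> 1"
  shows "\<exists>(A :: real poly) (B :: nat \<Rightarrow> real poly).
    (\<forall>x>-1. iter_log n j x = poly A x + (\<Sum>k=1..j. poly (B k) x * ln (1 + x) ^ k)) \<and>
    (\<forall>k\<in>{1..j}. \<exists>b\<in>\<rat>. B k = smult b ([:1, 1:] ^ n))"
proof -
  obtain A P where
    f: "\<And>x. x > -1 \<Longrightarrow> iter_log n j x = poly A x + (1 + x) ^ n * poly P (ln (1 + x))"
    and P: "\<And>i. coeff P i \<in> \<rat>" "degree P \<le> j"
    using iter_log_eq by blast
  \<comment> \<open>\<open>B 0\<close> is the log-free term, which joins \<open>A\<close>
    below.\<close>
  define B where "B k = smult (coeff P k) ([:1, 1:] ^ n)" for k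
  have P_eq: "poly P y = coeff P 0 + (\<Sum>k=1..j. coeff P k * y ^ k)" for y
  proof -
    have "poly P y = (\<Sum>k\<le>j. coeff P k * y ^ k)"
      using P(2) by (subst poly_altdef, intro sum.mono_neutral_left) (auto simp: coeff_eq_0)
    then show ?thesis
      by (simp add: atMost_atLeast0 sum.atLeast_Suc_atMost)
  qed
  have "iter_log n j x = poly (A + B 0) x + (\<Sum>k=1..j. poly (B k) x * ln (1 + x) ^ k)"
    if "x > -1" for x
    unfolding f[OF that] P_eq
    by (simp add: B_def distrib_left sum_distrib_left mult_ac poly_power)
  moreover have "\<forall>k\<in>{1..j}. \<exists>b\<in>\<rat>. B k = smult b ([:1, 1:] ^ n)"
    using P(1) unfolding B_def by blast
  ultimately show ?thesis
    by blast
qed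

end
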